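(* Let $v, e, r, c$ be positive integers with $r,c>1$, $ve=rc$ and $\max\{r,c\} < v \le \frac{rc}{2}$ (that is, a parameter set admissible for AO-arrays). Then there exist AO-arrays $S$ and $T$ such that the product construction (defined in the context) can be applied to $S$ and $T$, with suitable choices of the isotopic copies of $T$, so as to produce an $r\times c$ AO-array on $v$ symbols (with replication number $e$). In particular, an $r \times c$ AO-array on $v$ symbols exists for every admissible parameter set.
   Context: A row-column design is an array filled with symbols from a set of $v$ symbols such that no symbol occurs more than once in any row or in any column, and every symbol occurs exactly $e$ times in the array (replication number $e$). A $(v, e, -, -, \lambda_{rc} : r \times c)$ AO-array (adjusted orthogonal array) is an $r\times c$ row-column design on $v$ symbols with replication number $e$ in which every row and every column have exactly $\lambda_{rc}$ common symbols. The arrays $S$ and $T$ used as ingredients are allowed to be trivial (e.g. Latin rectangles, possibly with a single row or column). Two arrays are isotopic if one can be obtained from the other by permuting rows, permuting columns and renaming symbols by a bijection. Product construction: let $S$ be a $(v_S, e_S, -, -, \lambda_{rc}^S: r_S \times c_S)$ AO-array with symbols $s_1,\dots,s_{v_S}$, and let $T$ be a $(v_T, e_T, -, -, \lambda_{rc}^T: a \times b)$ AO-array. Take pairwise disjoint symbol sets $S_1,\dots,S_{v_S}$ with $|S_i|=v_T$ for all $i$. Replace each cell of $S$ containing symbol $s_i$ by an $a\times b$ AO-array isotopic to $T$ on the symbol set $S_i$, giving an $r_Sa\times c_Sb$ array on $v_Sv_T$ symbols. *)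

theory Defs
  imports Complex_Main "HOL-Library.Disjoint_Sets" "HOL-Combinatorics.Permutations"
begin

text \<open>
  An \<open>r \<times> c\<close> array is a function \<open>A\<close> of row and column indices, of which only the
  values at \<open>i < r\<close> and \<open>j < c\<close> matter.  The set \<open>V\<close> of symbols is always given explicitly.
\<close>

type_synonym 's array = "nat \<Rightarrow> nat \<Rightarrow> 's"

definition row_symbols :: "nat \<Rightarrow> 's array \<Rightarrow> nat \<Rightarrow> 's set" where
  "row_symbols c A i = (\<lambda>j. A i j) ` {..<c}"

definition column_symbols :: "nat \<Rightarrow> 's array \<Rightarrow> nat \<Rightarrow> 's set" where
  "column_symbols r A j = (\<lambda>i. A i j) ` {..<r}"

definition row_column_design ::
    "nat \<Rightarrow> nat \<Rightarrow> nat \<Rightarrow> nat \<Rightarrow> 's set \<Rightarrow> 's array \<Rightarrow> bool" where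
  "row_column_design v e r c V A \<longleftrightarrow>
     finite V \<and> card V = v \<and>
     (\<forall>i<r. \<forall>j<c. A i j \<in> V) \<and>
     (\<forall>i<r. inj_on (\<lambda>j. A i j) {..<c}) \<and>
     (\<forall>j<c. inj_on (\<lambda>i. A i j) {..<r}) \<and>
     (\<forall>x\<in>V. card {(i, j). i < r \<and> j < c \<and> A i j = x} = e)"

text \<open>
  \<open>AO_array v e l r c V A\<close>: \<open>A\<close> is a \<open>(v, e, -, -, l : r \<times> c)\<close> AO-array with symbol set \<open>V\<close>.
\<close>

definition AO_array ::
    "nat \<Rightarrow> nat \<Rightarrow> nat \<Rightarrow> nat \<Rightarrow> nat \<Rightarrow> 's set \<Rightarrow> 's array \<Rightarrow> bool" where
  "AO_array v e l r c V A \<longleftrightarrow>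
     row_column_design v e r c V A \<and>
     (\<forall>i<r. \<forall>j<c. card (row_symbols c A i \<inter> column_symbols r A j) = l)"

definition isotopic ::
    "nat \<Rightarrow> nat \<Rightarrow> 's set \<Rightarrow> 's array \<Rightarrow> 't set \<Rightarrow> 't array \<Rightarrow> bool" where
  "isotopic r c V A W B \<longleftrightarrow>
     (\<exists>p q f. p permutes {..<r} \<and> q permutes {..<c} \<and> bij_betw f V W \<and>
        (\<forall>i<r. \<forall>j<c. B i j = f (A (p i) (q j))))"

text \<open>
  \<open>product_construction rS cS VS S a b VT T W P\<close>: the array \<open>P\<close>, with symbol set \<open>W\<close>, is one of
  the possible results of the product construction applied to the \<open>rS \<times> cS\<close> array \<open>S\<close> and
  the \<open>a \<times> b\<close> array \<open>T\<close>.  The symbol set replacing \<open>s \<in> VS\<close> is \<open>U s\<close>, and the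
  \<open>a \<times> b\<close> block of \<open>P\<close> replacing the cell \<open>(i, j)\<close> of \<open>S\<close> may be any isotopic
  copy of \<open>T\<close> on \<open>U (S i j)\<close>, chosen independently for each cell.
\<close>

definition product_construction ::
    "nat \<Rightarrow> nat \<Rightarrow> 's set \<Rightarrow> 's array \<Rightarrow> nat \<Rightarrow> nat \<Rightarrow> 't set \<Rightarrow> 't array \<Rightarrow>
     'u set \<Rightarrow> 'u array \<Rightarrow> bool" where
  "product_construction rS cS VS S a b VT T W P \<longleftrightarrow>
     (\<exists>U. disjoint_family_on U VS \<and>
        (\<forall>s\<in>VS. finite (U s) \<and> card (U s) = card VT) \<and>
        W = (\<Union>s\<in>VS. U s) \<and>
        (\<forall>i<rS. \<forall>j<cS. isotopic a b VT T (U (S i j)) (\<lambda>k l. P (i * a + k) (j * b + l))))"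

end

theory Submission
  imports Defs "HOL-Library.Nat_Bijection" "HOL-Number_Theory.Cong"
begin

text \<open>
  Split \<open>e = p * q\<close> with \<open>r = p * m\<close> and \<open>c = n * q\<close>, so that \<open>v = m * n\<close>, and admissibility
  gives \<open>p < n\<close> and \<open>q < m\<close>.  Let \<open>S\<close> be a \<open>p \<times> n\<close> Latin rectangle on \<open>n\<close> symbols and \<open>T\<close> the
  transpose of a \<open>q \<times> m\<close> Latin rectangle on \<open>m\<close> symbols.  If every cell of \<open>S\<close> is replaced by
  the same copy of \<open>T\<close>, tagged with the symbol of that cell, then the row and column
  symbol sets of the result are Cartesian products of those of \<open>S\<close> and \<open>T\<close>, hence so are
  their intersections.
\<close>

text \<open>All conditions are symmetric in rows and columns. This turns a wide cyclic rectangle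
  into the tall ingredient \<open>T\<close>.\<close>

lemma AO_array_transpose:
  assumes "AO_array v e l r c V A"
  shows "AO_array v e l c r V (\<lambda>i j. A j i)"
proof -
  have "card {(i, j). i < c \<and> j < r \<and> A j i = x} = card {(i, j). i < r \<and> j < c \<and> A i j = x}" for x
    by (rule bij_betw_same_card[of prod.swap])
       (auto simp: bij_betw_def inj_on_def image_iff)
  then show ?thesis
    using assms
    by (auto simp: AO_array_def row_column_design_def row_symbols_def column_symbols_def Int_commute)
qed

text \<open>Injectivity of \<open>f\<close> on \<open>V\<close> makes images commute with
  intersections, so common symbols are neither lost nor created. Needed to pass from symbols that
  are pairs to natural numbers.\<close>

lemma AO_array_rename:
  assumes A: "AO_array v e l r c V A" and f: "inj_on f V"
  shows "AO_array v e l r c (f ` V) (\<lambda>i j. f (A i j))"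
proof -
  have V: "A i j \<in> V" if "i < r" "j < c" for i j
    using A that by (auto simp: AO_array_def row_column_design_def)
  have row: "row_symbols c A i \<subseteq> V" if "i < r" for i
    using V that by (auto simp: row_symbols_def)
  have col: "column_symbols r A j \<subseteq> V" if "j < c" for j
    using V that by (auto simp: column_symbols_def)
  have "card (row_symbols c (\<lambda>i j. f (A i j)) i \<inter> column_symbols r (\<lambda>i j. f (A i j)) j) = l"
    if "i < r" "j < c" for i j
  proof -
    have "row_symbols c (\<lambda>i j. f (A i j)) i \<inter> column_symbols r (\<lambda>i j. f (A i j)) j
        = f ` row_symbols c A i \<inter> f ` column_symbols r A j"
      by (simp add: row_symbols_def column_symbols_def image_image)
    also have "\<dots> = f ` (row_symbols c A i \<inter> column_symbols r A j)"
      by (rule inj_on_image_Int[OF f, symmetric]) (use row col that in auto)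
    also have "card \<dots> = card (row_symbols c A i \<inter> column_symbols r A j)"
      by (rule card_image) (use row that f in \<open>blast intro: inj_on_subset\<close>)
    finally show ?thesis
      using A that by (simp add: AO_array_def)
  qed
  moreover have "row_column_design v e r c (f ` V) (\<lambda>i j. f (A i j))"
  proof -
    have "{(i, j). i < r \<and> j < c \<and> f (A i j) = f x} = {(i, j). i < r \<and> j < c \<and> A i j = x}"
      if "x \<in> V" for x
      using V that f by (auto dest: inj_onD)
    moreover have "inj_on (\<lambda>j. f (A i j)) {..<c}" if "i < r" for i
      using A V f that by (auto simp: AO_array_def row_column_design_def inj_on_def)
    moreover have "inj_on (\<lambda>i. f (A i j)) {..<r}" if "j < c" for j
      using A V f that by (auto simp: AO_array_def row_column_design_def inj_on_def)
    ultimately show ?thesis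
      using A V f by (simp add: AO_array_def row_column_design_def card_image)
  qed
  ultimately show ?thesis
    by (simp add: AO_array_def)
qed

text \<open>Pairs make the symbol sets of different \<open>s\<close> disjoint automatically: the
  first component tags the copy of \<open>T\<close>.\<close>

definition block_product ::
    "nat \<Rightarrow> nat \<Rightarrow> 's array \<Rightarrow> 't array \<Rightarrow> ('s \<times> 't) array" where
  "block_product a b S T = (\<lambda>i j. (S (i div a) (j div b), T (i mod a) (j mod b)))"

lemma block_index_less:
  fixes i k m a :: nat
  assumes "i < m" "k < a"
  shows "i * a + k < m * a"
proof -
  have "i * a + k < Suc i * a" using assms by simp
  also have "\<dots> \<le> m * a" using assms by (intro mult_right_mono) auto
  finally show ?thesis .
qed

text \<open>Division with remainder identifies \<open>{..<m * a}\<close> with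
  \<open>{..<m} \<times> {..<a}\<close>. This is what makes row and column symbol sets of a block
  product Cartesian products.\<close>

lemma image_div_mod_lessThan:
  fixes m a :: nat
  shows "(\<lambda>i. (f (i div a), g (i mod a))) ` {..<m * a} = f ` {..<m} \<times> g ` {..<a}" (is "?L = ?R")
proof
  show "?L \<subseteq> ?R"
    \<comment> \<open>For \<open>a = 0\<close> the bound \<open>i mod a < a\<close> fails, but then
      there is no index \<open>i\<close>.\<close>
    by (cases "a = 0") (auto simp: less_mult_imp_div_less)
  show "?R \<subseteq> ?L"
  proof
    fix z assume "z \<in> ?R"
    then obtain i k where "i < m" "k < a" "z = (f i, g k)"
      by auto
    then show "z \<in> ?L"
      by (intro image_eqI[of _ _ "i * a + k"]) (auto simp: block_index_less)
  qed
qed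

lemma inj_on_div_mod_lessThan:
  fixes m a :: nat
  assumes "inj_on f {..<m}" "inj_on g {..<a}"
  shows "inj_on (\<lambda>i. (f (i div a), g (i mod a))) {..<m * a}"
proof (rule inj_onI)
  fix i j assume "i \<in> {..<m * a}" "j \<in> {..<m * a}"
    and eq: "(f (i div a), g (i mod a)) = (f (j div a), g (j mod a))"
  then have "i div a < m" "j div a < m" "i mod a < a" "j mod a < a"
    by (auto simp: less_mult_imp_div_less intro!: mod_less_divisor gr0I)
  with assms eq have "i div a = j div a" "i mod a = j mod a"
    by (auto dest: inj_onD)
  then show "i = j"
    by (metis div_mult_mod_eq)
qed

text \<open>An occurrence of \<open>(x, y)\<close> amounts to choosing a cell of \<open>S\<close>
  with entry \<open>x\<close> and, inside its block, a cell of \<open>T\<close> with entry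
  \<open>y\<close>.\<close>

lemma card_block_product_occurrences:
  "card {(i, j). i < rS * a \<and> j < cS * b \<and> block_product a b S T i j = (x, y)} =
   card {(i, j). i < rS \<and> j < cS \<and> S i j = x} * card {(k, l). k < a \<and> l < b \<and> T k l = y}"
proof -
  have "bij_betw (\<lambda>((i, j), (k, l)). (i * a + k, j * b + l))
     ({(i, j). i < rS \<and> j < cS \<and> S i j = x} \<times> {(k, l). k < a \<and> l < b \<and> T k l = y})
     {(i, j). i < rS * a \<and> j < cS * b \<and> block_product a b S T i j = (x, y)}"
    by (rule bij_betw_byWitness
          [where f' = "\<lambda>(i, j). ((i div a, j div b), (i mod a, j mod b))"])
       (auto simp: block_product_def block_index_less less_mult_imp_div_less
             intro!: mod_less_divisor gr0I)
  from bij_betw_same_card[OF this] show ?thesis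
    by (simp add: card_cartesian_product)
qed

text \<open>The intersection of two Cartesian products is the product of the intersections, so the
  numbers of common symbols multiply, as do the replication numbers.\<close>

lemma AO_array_block_product:
  assumes S: "AO_array vS eS lS rS cS VS S" and T: "AO_array vT eT lT a b VT T"
  shows "AO_array (vS * vT) (eS * eT) (lS * lT) (rS * a) (cS * b) (VS \<times> VT) (block_product a b S T)"
proof -
  let ?P = "block_product a b S T"
  have div_mod: "i div m < n \<and> i mod m < m" if "i < n * m" for i m n :: nat
    using that by (auto simp: less_mult_imp_div_less intro!: mod_less_divisor gr0I)
  have row: "row_symbols (cS * b) ?P i = row_symbols cS S (i div a) \<times> row_symbols b T (i mod a)" for i
    by (simp add: row_symbols_def block_product_def image_div_mod_lessThan)
  have col: "column_symbols (rS * a) ?P j = column_symbols rS S (j div b) \<times> column_symbols a T (j mod b)" for j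
    unfolding column_symbols_def block_product_def
    by (rule image_div_mod_lessThan[of "\<lambda>i. S i (j div b)" a "\<lambda>k. T k (j mod b)"])
  have "card (row_symbols (cS * b) ?P i \<inter> column_symbols (rS * a) ?P j) = lS * lT"
    if "i < rS * a" "j < cS * b" for i j
    using S T div_mod[OF that(1)] div_mod[OF that(2)]
    by (simp add: row col Times_Int_Times card_cartesian_product AO_array_def)
  moreover have "row_column_design (vS * vT) (eS * eT) (rS * a) (cS * b) (VS \<times> VT) ?P"
  proof -
    have "?P i j \<in> VS \<times> VT" if "i < rS * a" "j < cS * b" for i j
      using S T div_mod[OF that(1)] div_mod[OF that(2)]
      by (simp add: AO_array_def row_column_design_def block_product_def)
    moreover have "inj_on (\<lambda>j. ?P i j) {..<cS * b}" if "i < rS * a" for i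
      using S T div_mod[OF that] unfolding block_product_def
      by (intro inj_on_div_mod_lessThan) (simp_all add: AO_array_def row_column_design_def)
    moreover have "inj_on (\<lambda>i. ?P i j) {..<rS * a}" if "j < cS * b" for j
      using S T div_mod[OF that] unfolding block_product_def
      by (intro inj_on_div_mod_lessThan[of "\<lambda>i. S i (j div b)" _ "\<lambda>k. T k (j mod b)"])
         (simp_all add: AO_array_def row_column_design_def)
    ultimately show ?thesis
      using S T
      by (auto simp: AO_array_def row_column_design_def card_cartesian_product
          card_block_product_occurrences)
  qed
  ultimately show ?thesis
    by (simp add: AO_array_def)
qed

lemma product_construction_block_product:
  assumes S: "\<And>i j. i < rS \<Longrightarrow> j < cS \<Longrightarrow> S i j \<in> VS" and VT: "finite VT"
    and f: "inj_on f (VS \<times> VT)"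
  shows "product_construction rS cS VS S a b VT T (f ` (VS \<times> VT))
           (\<lambda>i j. f (block_product a b S T i j))"
proof -
  \<comment> \<open>The symbols for \<open>s\<close> are the codes of the slice of pairs with first
    component \<open>s\<close>; injectivity of \<open>f\<close> keeps the slices disjoint and of
    full size.\<close>
  define U where "U s = (\<lambda>t. f (s, t)) ` VT" for s
  have inj: "inj_on (\<lambda>t. f (s, t)) VT" if "s \<in> VS" for s
    using f that by (auto simp: inj_on_def)
  have "disjoint_family_on U VS"
    using f by (fastforce simp: disjoint_family_on_def U_def dest: inj_onD)
  moreover have "\<forall>s\<in>VS. finite (U s) \<and> card (U s) = card VT"
    using VT inj by (simp add: U_def card_image)
  moreover have "f ` (VS \<times> VT) = (\<Union>s\<in>VS. U s)"
    by (auto simp: U_def)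
  moreover have "isotopic a b VT T (U (S i j))
      (\<lambda>k l. f (block_product a b S T (i * a + k) (j * b + l)))" if "i < rS" "j < cS" for i j
    unfolding isotopic_def
  proof (intro exI conjI)
    \<comment> \<open>Every block is \<open>T\<close> with symbols renamed only; no rows or columns
      move.\<close>
    show "id permutes {..<a}" "id permutes {..<b}"
      by (simp_all add: permutes_id)
    show "bij_betw (\<lambda>t. f (S i j, t)) VT (U (S i j))"
      using inj S that by (simp add: bij_betw_def U_def)
  qed (simp add: block_product_def)
  ultimately show ?thesis
    unfolding product_construction_def by blast
qed

lemma inj_on_add_mod: "inj_on (\<lambda>j. (i + j) mod n) {..<n}" for i n :: nat
proof (rule inj_onI)
  fix j k assume *: "j \<in> {..<n}" "k \<in> {..<n}" "(i + j) mod n = (i + k) mod n"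
  then have "j mod n = k mod n"
    by (metis cong_add_lcancel_nat cong_def)
  with * show "j = k" by simp
qed

text \<open>Each row contains all \<open>n\<close> symbols, so it meets a column in that whole
  column, which has \<open>m\<close> distinct entries because \<open>m \<le> n\<close>.\<close>

lemma AO_array_cyclic:
  assumes "m \<le> n"
  shows "AO_array n m m m n {..<n} (\<lambda>i j. (i + j) mod n)" (is "AO_array _ _ _ _ _ _ ?A")
proof -
  have row_inj: "inj_on (\<lambda>j. ?A i j) {..<n}" for i
    by (rule inj_on_add_mod)
  have col_inj: "inj_on (\<lambda>i. ?A i j) {..<m}" for j
    using inj_on_add_mod[of j n] assms by (auto simp: add.commute intro: inj_on_subset)
  have row: "row_symbols n ?A i = {..<n}" for i
    unfolding row_symbols_def
    \<comment> \<open>An injective self-map of a finite set is onto.\<close>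
    by (rule endo_inj_surj) (auto simp: row_inj)
  have "card {(i, j). i < m \<and> j < n \<and> ?A i j = x} = m" if "x < n" for x
  proof -
    \<comment> \<open>Every row contains \<open>x\<close> exactly once, so the \<open>m\<close> rows
      give \<open>m\<close> occurrences.\<close>
    have "card {j. j < n \<and> ?A i j = x} = 1" for i
    proof -
      have "x \<in> row_symbols n ?A i"
        using row that by simp
      then obtain k where k: "k < n" "?A i k = x"
        unfolding row_symbols_def by blast
      have "j = k" if "j < n" "?A i j = x" for j
        using inj_onD[OF row_inj[of i], of j k] k that by simp
      with k have "{j. j < n \<and> ?A i j = x} = {k}"
        by blast
      then show ?thesis
        by simp
    qed
    moreover have "{(i, j). i < m \<and> j < n \<and> ?A i j = x}
        = (SIGMA i:{..<m}. {j. j < n \<and> ?A i j = x})"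
      by auto
    ultimately show ?thesis
      by (simp add: card_SigmaI)
  qed
  moreover have "card (row_symbols n ?A i \<inter> column_symbols m ?A j) = m" if "j < n" for i j
  proof -
    have "row_symbols n ?A i \<inter> column_symbols m ?A j = column_symbols m ?A j"
      using that by (auto simp: row column_symbols_def)
    then show ?thesis
      by (simp add: column_symbols_def card_image col_inj)
  qed
  ultimately show ?thesis
    using row_inj col_inj by (auto simp: AO_array_def row_column_design_def)
qed

theorem proposition4p5:
  fixes v e r c :: nat
  assumes "v > 0" and "e > 0" and "r > 1" and "c > 1"
    and "v * e = r * c"
    and "max r c < v" and "real v \<le> real (r * c) / 2"
  shows "(\<exists>vS eS lS rS cS (VS :: nat set) (S :: nat array)
            vT eT lT a b (VT :: nat set) (T :: nat array)
            l (W :: nat set) (P :: nat array).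
            AO_array vS eS lS rS cS VS S \<and>
            AO_array vT eT lT a b VT T \<and>
            product_construction rS cS VS S a b VT T W P \<and>
            r = rS * a \<and> c = cS * b \<and> v = vS * vT \<and>
            AO_array v e l r c W P) \<and>
         (\<exists>l (W :: nat set) (P :: nat array). AO_array v e l r c W P)"
proof -
  have "e dvd r * c"
    using assms(5) by (metis dvd_triv_right)
  \<comment> \<open>A divisor of a product splits into a divisor of each factor.\<close>
  then obtain p q where e: "e = p * q" and "p dvd r" "q dvd c"
    using division_decomp by blast
  then obtain m n where r: "r = p * m" and c: "c = n * q"
    by (metis dvdE mult.commute)
  have "v * (p * q) = (n * m) * (p * q)"
    using assms(5) by (simp add: e r c ac_simps)
  then have v: "v = n * m"
    using assms(2) e by simp
  \<comment> \<open>These are \<open>r < v\<close> and \<open>c < v\<close>; cancelling the common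
    factor gives room for both Latin rectangles.\<close>
  have "p * m < n * m" "n * q < n * m"
    using assms(6) by (simp_all add: r c v)
  then have "p \<le> n" "q \<le> m"
    by simp_all
  define S where "S = (\<lambda>i j. (i + j) mod n)"
  define T where "T = (\<lambda>i j. (j + i) mod m)"
  define f where "f = prod_encode"
  have S: "AO_array n p p p n {..<n} S"
    unfolding S_def using \<open>p \<le> n\<close> by (rule AO_array_cyclic)
  have T: "AO_array m q q m q {..<m} T"
    unfolding T_def by (rule AO_array_transpose[OF AO_array_cyclic[OF \<open>q \<le> m\<close>]])
  have f: "inj_on f ({..<n} \<times> {..<m})"
    unfolding f_def by (rule inj_prod_encode)
  have "product_construction p n {..<n} S m q {..<m} T (f ` ({..<n} \<times> {..<m}))
          (\<lambda>i j. f (block_product m q S T i j))"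
    by (rule product_construction_block_product[OF _ _ f])
       (use S in \<open>auto simp: AO_array_def row_column_design_def\<close>)
  \<comment> \<open>The factors contribute \<open>p\<close> and \<open>q\<close> common symbols, so
    here the number of common symbols equals \<open>e\<close>.\<close>
  moreover have "AO_array v e (p * q) r c (f ` ({..<n} \<times> {..<m}))
                   (\<lambda>i j. f (block_product m q S T i j))"
    unfolding v e r c by (rule AO_array_rename[OF AO_array_block_product[OF S T] f])
  ultimately show ?thesis
    using S T r c v by blast
qed

end
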